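(* Let $K$ be a field of prime characteristic $p$ with $[K:K^p]<\infty$, let $S=K[x_1,\dots,x_n]$ or $S=K[\![x_1,\dots,x_n]\!]$, let $e\ge 1$ and $q=p^e$. For every nonzero $f\in S$ and every $0\le k\le q-1$, the pair $(M_S(f^k,e),M_S(f^{q-k},e))$ is a matrix factorization of $f$.
   Context: For an $S$-module $M$, $F_*^e(M)$ is the $S$-module equal to $M$ as an abelian group (the element corresponding to $m$ is written $F_*^e(m)$) with $sF_*^e(m)=F_*^e(s^{p^e}m)$. Let $\Lambda_e$ be a basis of $K$ as a $K^{p^e}$-vector space, $\Delta_e=\{\lambda x_1^{a_1}\cdots x_n^{a_n}\mid \lambda\in\Lambda_e,\ 0\le a_i\le p^e-1\}$ and $r_e=|\Delta_e|=[K:K^p]^e q^n$. Then $\{F_*^e(j)\mid j\in\Delta_e\}$ is a basis of $F_*^e(S)$ as a free $S$-module. For $f\in S$, $M_S(f,e)=[f_{(i,j)}]_{i,j\in\Delta_e}$ is the $r_e\times r_e$ matrix over $S$ of the $S$-linear map $F_*^e(S)\to F_*^e(S)$, $F_*^e(s)\mapsto F_*^e(fs)$, in this basis; i.e. $F_*^e(jf)=\sum_{i\in\Delta_e}f_{(i,j)}F_*^e(i)$ for each $j\in\Delta_e$. A matrix factorization (of size $m$) of a nonzero element $f$ of a domain $S$ is a pair $(\phi,\psi)$ of $m\times m$ matrices over $S$ with $\phi\psi=\psi\phi=fI_m$. *)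

theory Defs
  imports Complex_Main "HOL-Library.Poly_Mapping" "HOL-Computational_Algebra.Primes"
begin

text \<open>
  The polynomial ring $K[x_i : i \in 'n]$ is the monoid algebra
  \<^typ>\<open>('n \<Rightarrow>\<^sub>0 nat) \<Rightarrow>\<^sub>0 'k\<close> with the convolution product of the library.
\<close>

type_synonym ('n, 'k) mpoly = "('n \<Rightarrow>\<^sub>0 nat) \<Rightarrow>\<^sub>0 'k"

definition mpoly_const :: "'k \<Rightarrow> ('n, 'k::comm_ring_1) mpoly" where
  "mpoly_const c = Poly_Mapping.single 0 c"

definition mpoly_var :: "'n \<Rightarrow> ('n, 'k::comm_ring_1) mpoly" where
  "mpoly_var i = Poly_Mapping.single (Poly_Mapping.single i 1) 1"

text \<open>
  For finite \<open>'n\<close> the following type is $K[[x_i : i \in 'n]]$: arbitrary families of coefficients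
  indexed by exponent vectors, with the Cauchy product.
\<close>

typedef ('n, 'k) mfps = "UNIV :: (('n \<Rightarrow>\<^sub>0 nat) \<Rightarrow> 'k) set"
  morphisms mfps_nth Abs_mfps ..

lemmas mfps_nth_Abs [simp] = Abs_mfps_inverse[OF UNIV_I]

lemma mfps_ext: "(\<And>m. mfps_nth f m = mfps_nth g m) \<Longrightarrow> f = g"
  by (metis ext mfps_nth_inject)

lemma finite_exponent_decomp: "finite {(a, b). a + b = (m :: 'n \<Rightarrow>\<^sub>0 nat)}"
proof -
  let ?A = "{a :: 'n \<Rightarrow>\<^sub>0 nat. \<exists>b. a + b = m}"
  let ?F = "{g. (\<forall>x. (x \<in> Poly_Mapping.keys m \<longrightarrow>
                     g x \<in> {..Max (insert 0 (Poly_Mapping.lookup m ` Poly_Mapping.keys m))})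
                   \<and> (x \<notin> Poly_Mapping.keys m \<longrightarrow> g x = (0::nat)))}"
  have "Poly_Mapping.lookup a \<in> ?F" if m: "a + b = m" for a b :: "'n \<Rightarrow>\<^sub>0 nat"
  proof (rule CollectI, intro allI conjI impI)
    fix x
    have le: "Poly_Mapping.lookup a x \<le> Poly_Mapping.lookup m x"
      by (simp add: m[symmetric] Poly_Mapping.lookup_add)
    show "Poly_Mapping.lookup a x
        \<in> {..Max (insert 0 (Poly_Mapping.lookup m ` Poly_Mapping.keys m))}"
      if "x \<in> Poly_Mapping.keys m"
    proof -
      have "Poly_Mapping.lookup m x \<le> Max (insert 0 (Poly_Mapping.lookup m ` Poly_Mapping.keys m))"
        by (rule Max_ge) (use that in auto)
      then show ?thesis
        using le order_trans by blast
    qed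
    show "Poly_Mapping.lookup a x = 0" if "x \<notin> Poly_Mapping.keys m"
      using le that by (simp add: in_keys_iff)
  qed
  then have "Poly_Mapping.lookup ` ?A \<subseteq> ?F"
    by (intro image_subsetI) (simp only: mem_Collect_eq, metis)
  moreover have "finite ?F"
    by (rule finite_set_of_finite_funs) auto
  ultimately have "finite (Poly_Mapping.lookup ` ?A)"
    by (rule finite_subset)
  then have "finite ?A"
    by (rule finite_imageD) (auto intro: inj_onI poly_mapping_eqI)
  moreover have "{(a, b). a + b = m} \<subseteq> (\<lambda>a. (a, m - a)) ` ?A"
    by auto
  ultimately show ?thesis
    by (meson finite_imageI finite_subset)
qed

instantiation mfps :: (type, comm_ring_1) comm_ring_1
begin

definition "0 = Abs_mfps (\<lambda>m. 0)"
definition "1 = Abs_mfps (\<lambda>m. if m = 0 then 1 else 0)"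
definition "f + g = Abs_mfps (\<lambda>m. mfps_nth f m + mfps_nth g m)"
definition "- f = Abs_mfps (\<lambda>m. - mfps_nth f m)"
definition "f - g = Abs_mfps (\<lambda>m. mfps_nth f m - mfps_nth g m)"
definition "f * g = Abs_mfps (\<lambda>m. \<Sum>(a, b) | a + b = m. mfps_nth f a * mfps_nth g b)"

instance
proof
  fix f g h :: "('a, 'b) mfps"
  note defs = zero_mfps_def one_mfps_def plus_mfps_def uminus_mfps_def minus_mfps_def times_mfps_def
  show "f + g + h = f + (g + h)" "f + g = g + f" "0 + f = f" "- f + f = 0" "f - g = f + - g"
    by (auto intro!: mfps_ext simp: defs algebra_simps)
  show "(f + g) * h = f * h + g * h"
    by (auto intro!: mfps_ext simp: defs algebra_simps sum.distrib case_prod_unfold)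
  show "f * g = g * f"
  proof (rule mfps_ext)
    fix m
    show "mfps_nth (f * g) m = mfps_nth (g * f) m"
      unfolding times_mfps_def mfps_nth_Abs
      by (rule sum.reindex_bij_witness[of _ prod.swap prod.swap]) (auto simp: add.commute mult.commute)
  qed
  show "1 * f = f"
  proof (rule mfps_ext)
    fix m
    have "mfps_nth (1 * f) m = (\<Sum>(a, b) | a + b = m. (if a = 0 then 1 else 0) * mfps_nth f b)"
      by (simp add: defs)
    also have "\<dots> = (\<Sum>(a, b) \<in> {(0 :: 'a \<Rightarrow>\<^sub>0 nat, m)}. (if a = 0 then 1 else 0) * mfps_nth f b)"
      by (rule sum.mono_neutral_right) (auto simp: finite_exponent_decomp split: if_splits)
    finally show "mfps_nth (1 * f) m = mfps_nth f m" by simp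
  qed
  have "mfps_nth (0 :: ('a, 'b) mfps) 0 \<noteq> mfps_nth (1 :: ('a, 'b) mfps) 0"
    by (simp add: zero_mfps_def one_mfps_def)
  then show "(0 :: ('a, 'b) mfps) \<noteq> 1"
    by metis
  show "f * g * h = f * (g * h)"
  proof (rule mfps_ext)
    fix m
    have fin: "finite {z. fst z + snd z = (n :: 'a \<Rightarrow>\<^sub>0 nat)}" for n
      using finite_exponent_decomp[of n] by (simp add: case_prod_unfold)
    have "mfps_nth (f * g * h) m =
        (\<Sum>x | fst x + snd x = m. \<Sum>y | fst y + snd y = fst x.
           mfps_nth f (fst y) * mfps_nth g (snd y) * mfps_nth h (snd x))"
      by (simp add: times_mfps_def case_prod_unfold sum_distrib_right)
    also have "\<dots> = (\<Sum>(x, y) \<in> (SIGMA x:{x. fst x + snd x = m}. {y. fst y + snd y = fst x}).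
           mfps_nth f (fst y) * mfps_nth g (snd y) * mfps_nth h (snd x))"
      by (rule sum.Sigma) (auto simp: fin)
    also have "\<dots> = (\<Sum>(x, y) \<in> (SIGMA x:{x. fst x + snd x = m}. {y. fst y + snd y = snd x}).
           mfps_nth f (fst x) * (mfps_nth g (fst y) * mfps_nth h (snd y)))"
      by (rule sum.reindex_bij_witness[of _
            "\<lambda>((a, b), (c, d)). ((a + c, d), (a, c))" "\<lambda>((a, b), (c, d)). ((c, d + b), (d, b))"])
         (auto simp: add.assoc mult.assoc)
    also have "\<dots> = (\<Sum>x | fst x + snd x = m. \<Sum>y | fst y + snd y = snd x.
           mfps_nth f (fst x) * (mfps_nth g (fst y) * mfps_nth h (snd y)))"
      by (rule sum.Sigma[symmetric]) (auto simp: fin)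
    also have "\<dots> = mfps_nth (f * (g * h)) m"
      by (simp add: times_mfps_def case_prod_unfold sum_distrib_left)
    finally show "mfps_nth (f * g * h) m = mfps_nth (f * (g * h)) m" .
  qed
qed

end

definition mfps_const :: "'k \<Rightarrow> ('n, 'k::comm_ring_1) mfps" where
  "mfps_const c = Abs_mfps (\<lambda>m. if m = 0 then c else 0)"

definition mfps_var :: "'n \<Rightarrow> ('n, 'k::comm_ring_1) mfps" where
  "mfps_var i = Abs_mfps (\<lambda>m. if m = Poly_Mapping.single i 1 then 1 else 0)"

text \<open>
  The library treats vector spaces over a field given as a type; here the field of scalars
  is a subfield \<open>F\<close> (a set) of the field \<open>'k\<close>.
\<close>

definition powers_subfield :: "nat \<Rightarrow> 'k::field set" where
  "powers_subfield r = range (\<lambda>x. x ^ r)"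

definition spans_over :: "'k::field set \<Rightarrow> 'k set \<Rightarrow> bool" where
  "spans_over F B \<longleftrightarrow>
     (\<forall>x. \<exists>A c. finite A \<and> A \<subseteq> B \<and> (\<forall>b\<in>A. c b \<in> F) \<and> x = (\<Sum>b\<in>A. c b * b))"

definition independent_over :: "'k::field set \<Rightarrow> 'k set \<Rightarrow> bool" where
  "independent_over F B \<longleftrightarrow>
     (\<forall>A c. finite A \<and> A \<subseteq> B \<and> (\<forall>b\<in>A. c b \<in> F) \<and> (\<Sum>b\<in>A. c b * b) = 0 \<longrightarrow> (\<forall>b\<in>A. c b = 0))"

definition basis_over :: "'k::field set \<Rightarrow> 'k set \<Rightarrow> bool" where
  "basis_over F B \<longleftrightarrow> spans_over F B \<and> independent_over F B"

definition finite_degree_over :: "'k::field set \<Rightarrow> bool" where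
  "finite_degree_over F \<longleftrightarrow> (\<exists>B. finite B \<and> basis_over F B)"

text \<open>
  $F_*^e(M)$ is $M$ as an abelian group, with a new scalar multiplication. It is represented by that
  scalar multiplication, and $F_*^e(m)$ by \<open>m\<close> itself. The argument \<open>scale\<close> is the
  scalar multiplication of $M$.
\<close>

definition frob_scale :: "nat \<Rightarrow> nat \<Rightarrow> ('s::comm_ring_1 \<Rightarrow> 'm \<Rightarrow> 'm) \<Rightarrow> 's \<Rightarrow> 'm \<Rightarrow> 'm" where
  "frob_scale p e scale s m = scale (s ^ (p ^ e)) m"

text \<open>
  In the next definitions \<open>C\<close> is the embedding of $K$ into $S$ and \<open>X i\<close> is the variable $x_i$,
  so that both rings are covered.
\<close>

definition Delta ::
  "('k \<Rightarrow> 's) \<Rightarrow> ('n::finite \<Rightarrow> 's) \<Rightarrow> 'k set \<Rightarrow> nat \<Rightarrow> 's::comm_ring_1 set" where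
  "Delta C X \<Lambda> q = {C l * (\<Prod>i\<in>UNIV. X i ^ a i) | l a. l \<in> \<Lambda> \<and> (\<forall>i. a i \<le> q - 1)}"

text \<open>
  \<^term>\<open>module.representation scale B v i\<close> is the coefficient of \<open>i\<close> in the expansion of \<open>v\<close> with
  respect to \<open>B\<close>. The library makes it \<open>0\<close> if \<open>B\<close> is dependent or does not span \<open>v\<close>.
\<close>

definition matrix_in_basis ::
  "('s::comm_ring_1 \<Rightarrow> 'm::ab_group_add \<Rightarrow> 'm) \<Rightarrow> 'm set \<Rightarrow> ('m \<Rightarrow> 'm) \<Rightarrow> 'm \<Rightarrow> 'm \<Rightarrow> 's" where
  "matrix_in_basis scale B T i j = module.representation scale B (T j) i"

definition M_matrix ::
  "nat \<Rightarrow> ('k \<Rightarrow> 's) \<Rightarrow> ('n::finite \<Rightarrow> 's) \<Rightarrow> 'k set \<Rightarrow> 's \<Rightarrow> nat \<Rightarrow> 's \<Rightarrow> 's \<Rightarrow> 's::comm_ring_1" where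
  "M_matrix p C X \<Lambda> f e =
     matrix_in_basis (frob_scale p e (*)) (Delta C X \<Lambda> (p ^ e)) (\<lambda>s. f * s)"

text \<open>
  Matrices whose rows and columns are indexed by a finite set \<open>I\<close>, so that the size of the
  factorization is \<^term>\<open>card I\<close>. Only entries with both indices in \<open>I\<close> matter.
\<close>

definition matrix_factorization ::
  "'i set \<Rightarrow> 's::comm_ring_1 \<Rightarrow> ('i \<Rightarrow> 'i \<Rightarrow> 's) \<Rightarrow> ('i \<Rightarrow> 'i \<Rightarrow> 's) \<Rightarrow> bool" where
  "matrix_factorization I f \<phi> \<psi> \<longleftrightarrow> finite I \<and> f \<noteq> 0 \<and>
     (\<forall>i\<in>I. \<forall>j\<in>I. (\<Sum>l\<in>I. \<phi> i l * \<psi> l j) = (if i = j then f else 0)) \<and>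
     (\<forall>i\<in>I. \<forall>j\<in>I. (\<Sum>l\<in>I. \<psi> i l * \<phi> l j) = (if i = j then f else 0))"

end

theory Submission
  imports Defs
begin

text \<open>
  Multiplication by \<open>f ^ k\<close> followed by multiplication by \<open>f ^ (q - k)\<close> is multiplication by
  \<open>f ^ q\<close>, and on $F_*^e(S)$ this is the scalar multiplication by \<open>f\<close>. Composition of
  endomorphisms of a finite free module corresponds to the product of their matrices, so the product
  of the two matrices, in either order, is \<open>f\<close> times the identity
  (\<open>frobenius_matrix_factorization\<close>). The content is therefore that \<open>Delta\<close> is a finite basis of
  $F_*^e(S)$.

  \<open>\<Lambda>\<close> is a basis of $F_*^e(K)$. It is finite because \<open>K\<close> is spanned over $K^{p^e}$ by the
  products of $p^i$-th powers of elements of a finite basis of \<open>K\<close> over $K^p$, and an independent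
  set is no larger than a finite spanning set (\<open>finite_basis_of_frobenius_field\<close>).

  To pass from \<open>K\<close> to \<open>S\<close>, compare coefficients. The coefficient of \<open>u ^ q\<close> at \<open>q m\<close> is
  the \<open>q\<close>-th power of the coefficient of \<open>u\<close> at \<open>m\<close>, and \<open>u ^ q\<close> has no other coefficients
  (\<open>coef_frobenius\<close>). Every exponent vector is \<open>q m + a\<close> for exactly one \<open>m\<close> and one \<open>a\<close> with
  all entries below \<open>q\<close>, so the coefficient of
  $\sum_{\lambda,a} u_{\lambda,a}^q \lambda x^a$ there is
  $\sum_\lambda (u_{\lambda,a})_m^q \lambda$, where $(u)_m$ is the coefficient of \<open>u\<close> at \<open>m\<close>
  (\<open>coef_frobenius_combination\<close>). Hence an expansion of an element of \<open>S\<close> in \<open>Delta\<close> is the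
  same as an expansion of each of its coefficients in \<open>\<Lambda>\<close>. Only the coefficient functional is used,
  so one argument, in the locale \<open>coefficient_ring\<close>, covers polynomials and power series.
\<close>

section \<open>Matrices of endomorphisms\<close>

context module
begin

lemma sum_representation_apply:
  assumes B: "finite B" "independent B" "span B = UNIV"
    and T: "module_hom scale scale T"
  shows "(\<Sum>l\<in>B. representation B (T l) i * representation B v l) = representation B (T v) i"
proof -
  interpret T: module_hom scale scale T by (rule T)
  have "v = (\<Sum>l\<in>B. representation B v l *s l)"
    using B by (simp add: sum_representation_eq)
  then have "T v = T (\<Sum>l\<in>B. representation B v l *s l)"
    by simp
  also have "\<dots> = (\<Sum>l\<in>B. representation B v l *s T l)"
    by (simp add: T.sum T.scale)
  finally have "representation B (T v) i = (\<Sum>l\<in>B. representation B (representation B v l *s T l) i)"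
    using B by (simp add: representation_sum)
  then show ?thesis
    using B by (simp add: representation_scale mult.commute)
qed

lemma sum_matrix_in_basis_mult:
  assumes B: "finite B" "independent B" "span B = UNIV"
    and T: "module_hom scale scale T"
    and comp: "T (U j) = f *s j" and j: "j \<in> B"
  shows "(\<Sum>l\<in>B. matrix_in_basis scale B T i l * matrix_in_basis scale B U l j)
      = (if i = j then f else 0)"
proof -
  have "(\<Sum>l\<in>B. matrix_in_basis scale B T i l * matrix_in_basis scale B U l j)
      = representation B (f *s j) i"
    by (simp add: matrix_in_basis_def sum_representation_apply[OF B T] comp)
  then show ?thesis
    using B j by (simp add: representation_scale representation_basis)
qed

end

section \<open>The Frobenius push-forward of a ring\<close>

lemma module_frob_scale:
  assumes "prime p" "CHAR('s::comm_ring_1) = p"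
  shows "module (frob_scale p e ((*) :: 's \<Rightarrow> 's \<Rightarrow> 's))"
proof
  fix a b x y :: 's
  have "(a + b) ^ (p ^ e) = a ^ (p ^ e) + b ^ (p ^ e)"
    using assms by (intro freshmans_dream') auto
  then show "frob_scale p e (*) (a + b) x = frob_scale p e (*) a x + frob_scale p e (*) b x"
    by (simp add: frob_scale_def algebra_simps)
qed (auto simp: frob_scale_def algebra_simps power_mult_distrib)

lemma frobenius_matrix_factorization:
  fixes C :: "'k \<Rightarrow> 's::comm_ring_1" and X :: "'n::finite \<Rightarrow> 's"
  assumes p: "prime p" "CHAR('s) = p"
    and fin: "finite (Delta C X \<Lambda> (p ^ e))"
    and indep: "\<not> module.dependent (frob_scale p e (*)) (Delta C X \<Lambda> (p ^ e))"
    and span: "module.span (frob_scale p e (*)) (Delta C X \<Lambda> (p ^ e)) = UNIV"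
    and k: "k \<le> p ^ e" and f: "f \<noteq> 0"
  shows "matrix_factorization (Delta C X \<Lambda> (p ^ e)) f
           (M_matrix p C X \<Lambda> (f ^ k) e) (M_matrix p C X \<Lambda> (f ^ (p ^ e - k)) e)"
proof -
  interpret F: module "frob_scale p e ((*) :: 's \<Rightarrow> 's \<Rightarrow> 's)"
    by (rule module_frob_scale[OF p])
  have hom: "module_hom (frob_scale p e (*)) (frob_scale p e (*)) (\<lambda>s. g * s)" for g :: 's
    by unfold_locales (auto simp: frob_scale_def algebra_simps)
  have "f ^ k * (f ^ (p ^ e - k) * s) = frob_scale p e (*) f s"
    and "f ^ (p ^ e - k) * (f ^ k * s) = frob_scale p e (*) f s" for s
    using k by (simp_all add: frob_scale_def mult.assoc[symmetric] power_add[symmetric])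
  then show ?thesis
    unfolding matrix_factorization_def M_matrix_def
    using fin f F.sum_matrix_in_basis_mult[OF fin indep span hom] by simp
qed

section \<open>Bases of a field over its subfield of powers\<close>

lemma powers_subfield_choice:
  assumes "\<forall>b\<in>A. c b \<in> powers_subfield r"
  obtains d where "\<And>b. b \<in> A \<Longrightarrow> c b = d b ^ r"
proof -
  have "\<forall>b\<in>A. \<exists>x. c b = x ^ r"
    using assms by (auto simp: powers_subfield_def)
  then show ?thesis
    by (metis that)
qed

context
  fixes p e :: nat and \<Lambda> :: "'k::field set"
  assumes p: "prime p" "CHAR('k) = p"
    and basis: "basis_over (powers_subfield (p ^ e)) \<Lambda>"
begin

lemma independent_of_basis_over: "\<not> module.dependent (frob_scale p e (*)) \<Lambda>"
proof -
  interpret F: module "frob_scale p e ((*) :: 'k \<Rightarrow> 'k \<Rightarrow> 'k)"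
    by (rule module_frob_scale[OF p])
  show ?thesis
    unfolding F.independent_explicit_module
  proof (intro allI impI)
    fix A u b
    assume A: "finite A" "A \<subseteq> \<Lambda>" and 0: "(\<Sum>v\<in>A. frob_scale p e (*) (u v) v) = 0" and b: "b \<in> A"
    let ?c = "\<lambda>v. u v ^ (p ^ e)"
    have "finite A \<and> A \<subseteq> \<Lambda> \<and> (\<forall>v\<in>A. ?c v \<in> powers_subfield (p ^ e)) \<and> (\<Sum>v\<in>A. ?c v * v) = 0
        \<longrightarrow> (\<forall>v\<in>A. ?c v = 0)"
      using basis unfolding basis_over_def independent_over_def by (elim conjE allE)
    moreover have "\<forall>v\<in>A. ?c v \<in> powers_subfield (p ^ e)"
      by (simp add: powers_subfield_def)
    moreover have "(\<Sum>v\<in>A. ?c v * v) = 0"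
      using 0 by (simp add: frob_scale_def)
    ultimately have "\<forall>v\<in>A. ?c v = 0"
      using A by blast
    then show "u b = 0"
      using b by simp
  qed
qed

lemma span_of_basis_over: "module.span (frob_scale p e (*)) \<Lambda> = UNIV"
proof -
  interpret F: module "frob_scale p e ((*) :: 'k \<Rightarrow> 'k \<Rightarrow> 'k)"
    by (rule module_frob_scale[OF p])
  have "x \<in> F.span \<Lambda>" for x
  proof -
    obtain A c where A: "A \<subseteq> \<Lambda>" "\<forall>b\<in>A. c b \<in> powers_subfield (p ^ e)" and x: "x = (\<Sum>b\<in>A. c b * b)"
      using basis unfolding basis_over_def spans_over_def by meson
    obtain d where "\<And>b. b \<in> A \<Longrightarrow> c b = d b ^ (p ^ e)"
      using powers_subfield_choice[OF A(2)] by blast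
    then have "x = (\<Sum>b\<in>A. frob_scale p e (*) (d b) b)"
      by (simp add: x frob_scale_def)
    also have "\<dots> \<in> F.span \<Lambda>"
      using A by (intro F.span_sum F.span_scale F.span_base) auto
    finally show ?thesis .
  qed
  then show ?thesis by auto
qed

end

text \<open>
  If \<open>B\<close> spans over the \<open>p\<close>-th powers and \<open>D\<close> over the $p^e$-th powers, then the products
  $b\,d^{p^e}$ with \<open>b\<close> in \<open>D\<close> and \<open>d\<close> in \<open>B\<close> span over the $p^{e+1}$-th powers: expand the
  $p^e$-th root of each coefficient with respect to \<open>B\<close>.
\<close>

lemma finite_spanning_frobenius_field:
  fixes p e :: nat
  assumes p: "prime p" "CHAR('k::field) = p"
    and fin: "finite_degree_over (powers_subfield p :: 'k set)"
  shows "\<exists>D. finite D \<and> module.span (frob_scale p e ((*) :: 'k \<Rightarrow> 'k \<Rightarrow> 'k)) D = UNIV"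
proof (induction e)
  case 0
  interpret F: module "frob_scale p 0 ((*) :: 'k \<Rightarrow> 'k \<Rightarrow> 'k)"
    by (rule module_frob_scale[OF p])
  have "x \<in> F.span {1}" for x
    using F.span_scale[OF F.span_base[of 1 "{1}"], of x] by (simp add: frob_scale_def)
  then show ?case by (intro exI[of _ "{1}"]) auto
next
  case (Suc e)
  interpret F1: module "frob_scale p 1 ((*) :: 'k \<Rightarrow> 'k \<Rightarrow> 'k)"
    by (rule module_frob_scale[OF p])
  interpret F: module "frob_scale p e ((*) :: 'k \<Rightarrow> 'k \<Rightarrow> 'k)"
    by (rule module_frob_scale[OF p])
  interpret G: module "frob_scale p (Suc e) ((*) :: 'k \<Rightarrow> 'k \<Rightarrow> 'k)"
    by (rule module_frob_scale[OF p])
  obtain B :: "'k set" where B: "finite B" "basis_over (powers_subfield (p ^ 1)) B"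
    using fin unfolding finite_degree_over_def by auto
  have B_span: "F1.span B = UNIV"
    by (rule span_of_basis_over[OF p B(2)])
  obtain D where D: "finite D" "F.span D = UNIV"
    using Suc.IH by blast
  let ?E = "(\<lambda>(b, d). b * d ^ (p ^ e)) ` (D \<times> B)"
  have "x \<in> G.span ?E" for x
  proof -
    obtain c where c: "x = (\<Sum>b\<in>D. frob_scale p e (*) (c b) b)"
      using UNIV_I[of x] unfolding D(2)[symmetric] F.span_finite[OF D(1)] by (elim rangeE)
    have "\<exists>g. y = (\<Sum>d\<in>B. frob_scale p 1 (*) (g d) d)" for y
      using UNIV_I[of y] unfolding B_span[symmetric] F1.span_finite[OF B(1)]
      by (elim rangeE) (rule exI)
    then have "\<exists>g. \<forall>y. y = (\<Sum>d\<in>B. frob_scale p 1 (*) (g y d) d)"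
      by (intro choice allI)
    then obtain g where g: "\<And>y. y = (\<Sum>d\<in>B. frob_scale p 1 (*) (g y d) d)"
      by blast
    have pow: "y ^ (p ^ e) = (\<Sum>d\<in>B. g y d ^ (p ^ Suc e) * d ^ (p ^ e))" for y
    proof -
      have "y ^ (p ^ e) = (\<Sum>d\<in>B. frob_scale p 1 (*) (g y d) d) ^ (p ^ e)"
        using g[of y] by simp
      also have "\<dots> = (\<Sum>d\<in>B. frob_scale p 1 (*) (g y d) d ^ (p ^ e))"
        by (rule freshmans_dream_sum') (use p in auto)
      finally show ?thesis
        by (simp add: frob_scale_def power_mult_distrib power_mult)
    qed
    have "x = (\<Sum>b\<in>D. c b ^ (p ^ e) * b)"
      using c by (simp add: frob_scale_def)
    also have "\<dots> = (\<Sum>b\<in>D. \<Sum>d\<in>B. frob_scale p (Suc e) (*) (g (c b) d) (b * d ^ (p ^ e)))"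
    proof (rule sum.cong)
      fix b
      show "c b ^ (p ^ e) * b = (\<Sum>d\<in>B. frob_scale p (Suc e) (*) (g (c b) d) (b * d ^ (p ^ e)))"
        by (subst pow) (simp add: frob_scale_def sum_distrib_left mult_ac)
    qed simp
    also have "\<dots> \<in> G.span ?E"
      by (intro G.span_sum G.span_scale G.span_base) auto
    finally show ?thesis .
  qed
  then show ?case
    using B D by (intro exI[of _ ?E]) auto
qed

lemma finite_basis_of_frobenius_field:
  fixes \<Lambda> :: "'k::field set"
  assumes p: "prime p" "CHAR('k) = p"
    and fin: "finite_degree_over (powers_subfield p :: 'k set)"
    and basis: "basis_over (powers_subfield (p ^ e)) \<Lambda>"
  shows "finite \<Lambda>"
proof -
  interpret V: vector_space "frob_scale p e ((*) :: 'k \<Rightarrow> 'k \<Rightarrow> 'k)"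
    using module_frob_scale[OF p] by (simp add: module_iff_vector_space)
  obtain D where D: "finite D" "V.span D = UNIV"
    using finite_spanning_frobenius_field[OF p fin] by blast
  show ?thesis
    using V.independent_span_bound[OF D(1), of \<Lambda>] independent_of_basis_over[OF p basis] D(2) by simp
qed

section \<open>Exponent vectors\<close>

text \<open>
  For finitely many variables every family of exponents has finite support, so exponent vectors
  can be given by arbitrary functions.
\<close>

definition exponent :: "('n::finite \<Rightarrow> nat) \<Rightarrow> 'n \<Rightarrow>\<^sub>0 nat" where
  "exponent a = Abs_poly_mapping a"

lemma lookup_exponent [simp]: "Poly_Mapping.lookup (exponent a) = a"
  by (simp add: exponent_def)

lemma exponent_lookup [simp]: "exponent (Poly_Mapping.lookup m) = m"
  by (rule poly_mapping_eqI) simp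

lemma exponent_inject [simp]: "exponent a = exponent b \<longleftrightarrow> a = b"
  by (metis lookup_exponent)

lemma exponent_add: "exponent a + exponent b = exponent (\<lambda>i. a i + b i)"
  by (rule poly_mapping_eqI) (simp add: lookup_add)

lemma exponent_0 [simp]: "exponent (\<lambda>i. 0) = 0"
  by (rule poly_mapping_eqI) simp

definition box :: "nat \<Rightarrow> ('n::finite \<Rightarrow> nat) set" where
  "box q = {a. \<forall>i. a i \<le> q - 1}"

lemma finite_box: "finite (box q :: ('n::finite \<Rightarrow> nat) set)"
proof -
  have "finite {a :: 'n \<Rightarrow> nat. \<forall>i. (i \<in> UNIV \<longrightarrow> a i \<in> {..q - 1}) \<and> (i \<notin> UNIV \<longrightarrow> a i = 0)}"
    by (rule finite_set_of_finite_funs) auto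
  then show ?thesis by (simp add: box_def)
qed

section \<open>Rings whose elements are determined by coefficients\<close>

text \<open>
  The last assumption supplies elements with prescribed coefficients. It is used with
  \<open>h m = q m + a\<close> and a coordinate with respect to \<open>\<Lambda>\<close> as \<open>\<phi>\<close>. Injectivity of \<open>h\<close> and
  \<open>\<phi> 0 = 0\<close> make it true for polynomials, because they preserve finiteness of the support.
\<close>

locale coefficient_ring =
  fixes C :: "'k::field \<Rightarrow> 's::comm_ring_1" and X :: "'n::finite \<Rightarrow> 's"
    and coef :: "'s \<Rightarrow> ('n \<Rightarrow>\<^sub>0 nat) \<Rightarrow> 'k"
  assumes coef_ext: "(\<And>m. coef f m = coef g m) \<Longrightarrow> f = g"
    and coef_add: "coef (f + g) m = coef f m + coef g m"
    and coef_mult: "coef (f * g) m = (\<Sum>(a, b) | a + b = m. coef f a * coef g b)"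
    and coef_C: "coef (C c) m = (if m = 0 then c else 0)"
    and coef_X: "coef (X i) m = (if m = Poly_Mapping.single i 1 then 1 else 0)"
    and coef_closed: "\<phi> 0 = 0 \<Longrightarrow> inj h \<Longrightarrow> \<exists>u. \<forall>m. coef u m = \<phi> (coef f (h m))"
begin

lemma coef_0 [simp]: "coef 0 m = 0"
  using coef_add[of 0 0 m] add_cancel_right_right[of "coef 0 m" "coef 0 m"] by simp

lemma coef_sum: "coef (sum g A) m = (\<Sum>x\<in>A. coef (g x) m)"
  by (induction A rule: infinite_finite_induct) (auto simp: coef_add)

lemma coef_diff: "coef (f - g) m = coef f m - coef g m"
  using coef_add[of "f - g" g m] by simp

lemma coef_mult_eq_0:
  assumes "\<And>a b. a + b = m \<Longrightarrow> coef f a = 0"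
  shows "coef (f * g) m = 0"
  unfolding coef_mult using assms by (intro sum.neutral) auto

definition is_term :: "'s \<Rightarrow> ('n \<Rightarrow>\<^sub>0 nat) \<Rightarrow> 'k \<Rightarrow> bool" where
  "is_term f a c \<longleftrightarrow> (\<forall>m. coef f m = (if m = a then c else 0))"

lemma is_termD: "is_term f a c \<Longrightarrow> coef f m = (if m = a then c else 0)"
  by (simp add: is_term_def)

lemma coef_mult_term:
  assumes "is_term t b c"
  shows "coef (f * t) (d + b) = coef f d * c"
proof -
  have "coef (f * t) (d + b) = (\<Sum>(x, y) | x + y = d + b. coef f x * (if y = b then c else 0))"
    unfolding coef_mult by (simp add: is_termD[OF assms])
  also have "\<dots> = (\<Sum>(x, y)\<in>{(d, b)}. coef f x * (if y = b then c else 0))"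
    by (rule sum.mono_neutral_right) (auto simp: finite_exponent_decomp split: if_splits)
  finally show ?thesis by simp
qed

lemma coef_mult_term_eq_0:
  assumes "is_term t b c" "\<And>d. m = d + b \<Longrightarrow> coef f d = 0"
  shows "coef (f * t) m = 0"
  unfolding coef_mult using assms by (intro sum.neutral) (auto simp: is_termD)

lemma is_term_mult:
  assumes "is_term s a c" "is_term t b d"
  shows "is_term (s * t) (a + b) (c * d)"
  unfolding is_term_def
proof
  fix m
  show "coef (s * t) m = (if m = a + b then c * d else 0)"
  proof (cases "m = a + b")
    case True
    then show ?thesis
      by (simp add: coef_mult_term[OF assms(2)] is_termD[OF assms(1)])
  next
    case False
    then show ?thesis
      by (auto intro!: coef_mult_term_eq_0[OF assms(2)] simp: is_termD[OF assms(1)])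
  qed
qed

lemma is_term_C: "is_term (C c) 0 c"
  by (simp add: is_term_def coef_C)

lemma C_1: "C 1 = 1"
proof -
  have "1 * C 1 = (1 :: 's)"
    by (rule coef_ext) (use coef_mult_term[OF is_term_C, of 1 1] in simp)
  then show ?thesis by simp
qed

lemma is_term_1: "is_term 1 0 1"
  using is_term_C[of 1] by (simp add: C_1)

lemma is_term_power:
  assumes "is_term t (exponent a) c"
  shows "is_term (t ^ r) (exponent (\<lambda>i. r * a i)) (c ^ r)"
proof (induction r)
  case (Suc r)
  then show ?case
    using is_term_mult[OF assms Suc] by (simp add: exponent_add)
qed (simp add: is_term_1)

definition monomial :: "'k \<Rightarrow> ('n \<Rightarrow> nat) \<Rightarrow> 's" where
  "monomial c a = C c * (\<Prod>i\<in>UNIV. X i ^ a i)"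

lemma is_term_monomial: "is_term (monomial c a) (exponent a) c"
proof -
  have X: "is_term (X i) (exponent (\<lambda>j. if j = i then 1 else 0)) 1" for i
  proof -
    have "exponent (\<lambda>j. if j = i then 1 else 0) = Poly_Mapping.single i 1"
      by (rule poly_mapping_eqI) (simp add: lookup_single when_def)
    then show ?thesis
      by (simp add: is_term_def coef_X)
  qed
  have "is_term (\<Prod>i\<in>A. X i ^ a i) (exponent (\<lambda>j. if j \<in> A then a j else 0)) 1" for A
    using finite[of A]
  proof (induction A)
    case (insert i A)
    have "exponent (\<lambda>j. a i * (if j = i then 1 else 0)) + exponent (\<lambda>j. if j \<in> A then a j else 0)
        = exponent (\<lambda>j. if j \<in> insert i A then a j else 0)"
      unfolding exponent_add using insert.hyps by (auto intro!: arg_cong[of _ _ exponent])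
    then show ?case
      using is_term_mult[OF is_term_power[OF X[of i], of "a i"] insert.IH] insert.hyps by simp
  qed (simp add: is_term_1)
  from is_term_mult[OF is_term_C this[of UNIV]] show ?thesis
    by (simp add: monomial_def)
qed

lemma CHAR_eq: "CHAR('s) = CHAR('k)"
proof -
  have "coef (of_nat r) m = (if m = 0 then of_nat r else 0)" for r m
    by (induction r) (auto simp: coef_add is_termD[OF is_term_1])
  then have "(of_nat r :: 's) = 0 \<longleftrightarrow> (of_nat r :: 'k) = 0" for r
    by (auto dest: arg_cong[of "of_nat r :: 's" 0 "\<lambda>f. coef f 0"] intro!: coef_ext)
  then show ?thesis
    by (intro CHAR_eqI) (auto simp: of_nat_eq_0_iff_char_dvd)
qed

lemma Delta_eq: "Delta C X \<Lambda> q = (\<lambda>(l, a). monomial l a) ` (\<Lambda> \<times> box q)"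
  by (auto simp: Delta_def monomial_def box_def)

lemma inj_on_monomial:
  assumes "0 \<notin> \<Lambda>"
  shows "inj_on (\<lambda>(l, a). monomial l a) (\<Lambda> \<times> A)"
proof (rule inj_onI, clarify)
  fix l l' a a'
  assume l: "l \<in> \<Lambda>" "l' \<in> \<Lambda>" and eq: "monomial l a = monomial l' a'"
  have "(if exponent a = exponent a' then l' else 0) = l"
    using is_termD[OF is_term_monomial, of l a "exponent a"]
      is_termD[OF is_term_monomial, of l' a' "exponent a"] eq by simp
  with l assms show "l = l' \<and> a = a'"
    by (auto split: if_splits)
qed

end

section \<open>The push-forward of a coefficient ring\<close>

locale frobenius_coefficient_ring = coefficient_ring C X coef
  for C :: "'k::field \<Rightarrow> 's::comm_ring_1" and X :: "'n::finite \<Rightarrow> 's"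
    and coef :: "'s \<Rightarrow> ('n \<Rightarrow>\<^sub>0 nat) \<Rightarrow> 'k" +
  fixes p e q :: nat
  assumes p: "prime p" "CHAR('k) = p" and q: "q = p ^ e"
begin

lemma CHAR_S: "CHAR('s) = p"
  using CHAR_eq p by simp

lemma q_pos: "q > 0"
  using p by (simp add: q prime_gt_0_nat)

lemma less_q: "a \<in> box q \<Longrightarrow> a i < q"
  using q_pos by (auto simp: box_def intro: le_less_trans[of _ "q - 1"])

text \<open>
  Taking \<open>q\<close>-th powers is additive but need not commute with infinite sums. The coefficient of a
  product at \<open>m\<close> depends only on the finitely many coefficients at the summands of \<open>m\<close>, so \<open>u\<close>
  may be replaced by a finite sum of terms.
\<close>

lemma coef_frobenius:
  "coef (u ^ q) m =
    (if \<forall>i. q dvd Poly_Mapping.lookup m i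
     then coef u (exponent (\<lambda>i. Poly_Mapping.lookup m i div q)) ^ q else 0)"
proof -
  let ?A = "fst ` {(a, b). a + b = m}"
  let ?t = "\<lambda>a. monomial (coef u a) (Poly_Mapping.lookup a)"
  let ?root = "exponent (\<lambda>i. Poly_Mapping.lookup m i div q)"
  have fin: "finite ?A"
    by (intro finite_imageI finite_exponent_decomp)
  define u0 where "u0 = (\<Sum>a\<in>?A. ?t a)"
  have trm: "is_term (?t a) a (coef u a)" for a
    using is_term_monomial[of "coef u a" "Poly_Mapping.lookup a"] by simp
  have "coef (u - u0) a = 0" if "a \<in> ?A" for a
    using that fin by (simp add: u0_def coef_diff coef_sum is_termD[OF trm])
  then have vanish: "coef (u - u0) a = 0" if "a + b = m" for a b
    using that by force
  have "(u - u0) ^ q = (u - u0) * (u - u0) ^ (q - 1)"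
    using q_pos by (metis Suc_pred' power_Suc One_nat_def)
  \<comment> \<open>One factor suffices: elements vanishing at all summands of \<open>m\<close> form an ideal.\<close>
  then have rest: "coef ((u - u0) ^ q) m = 0"
    by (simp add: coef_mult_eq_0 vanish)
  have "u ^ q = ((u - u0) + u0) ^ q"
    by simp
  also have "\<dots> = (u - u0) ^ q + u0 ^ q"
    by (rule freshmans_dream') (use p CHAR_S q in auto)
  finally have "coef (u ^ q) m = coef (u0 ^ q) m"
    by (simp add: coef_add rest)
  also have "u0 ^ q = (\<Sum>a\<in>?A. ?t a ^ q)"
    unfolding u0_def by (rule freshmans_dream_sum') (use p CHAR_S q in auto)
  also have "coef \<dots> m =
      (\<Sum>a\<in>?A. if m = exponent (\<lambda>i. q * Poly_Mapping.lookup a i) then coef u a ^ q else 0)"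
    using is_termD[OF is_term_power[OF is_term_monomial]] by (simp add: coef_sum)
  also have "\<dots> = (if \<forall>i. q dvd Poly_Mapping.lookup m i then coef u ?root ^ q else 0)"
  proof (cases "\<forall>i. q dvd Poly_Mapping.lookup m i")
    case True
    have root: "m = exponent (\<lambda>i. q * Poly_Mapping.lookup a i) \<longleftrightarrow> ?root = a" for a
    proof
      show "?root = a" if "m = exponent (\<lambda>i. q * Poly_Mapping.lookup a i)"
        using q_pos by (simp add: that)
      show "m = exponent (\<lambda>i. q * Poly_Mapping.lookup a i)" if "?root = a"
        using True by (simp flip: that)
    qed
    have "?root + exponent (\<lambda>i. Poly_Mapping.lookup m i - Poly_Mapping.lookup m i div q) = m"
      by (simp add: exponent_add)
    then have "?root \<in> ?A"
      by force
    then show ?thesis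
      using True fin unfolding root by simp
  next
    case False
    have "m \<noteq> exponent (\<lambda>i. q * Poly_Mapping.lookup a i)" for a
      using False by (metis dvd_triv_left lookup_exponent)
    with False show ?thesis
      by (simp only: if_False sum.neutral_const)
  qed
  finally show ?thesis .
qed

text \<open>
  Reducing modulo \<open>q\<close> separates the monomials of \<open>Delta\<close>: \<open>u ^ q\<close> times the monomial with
  exponents \<open>b\<close> only has coefficients at exponents congruent to \<open>b\<close>.
\<close>

lemma coef_frobenius_mult_monomial:
  assumes a: "a \<in> box q" and b: "b \<in> box q"
  shows "coef (u ^ q * monomial l b) (exponent (\<lambda>i. q * Poly_Mapping.lookup m i + a i)) =
      (if a = b then coef u m ^ q * l else 0)" (is "?lhs = _")
proof (cases "a = b")
  case True
  have "?lhs = coef (u ^ q) (exponent (\<lambda>i. q * Poly_Mapping.lookup m i)) * l"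
    using coef_mult_term[OF is_term_monomial, of "u ^ q" l b
        "exponent (\<lambda>i. q * Poly_Mapping.lookup m i)"]
    by (simp add: exponent_add True)
  also have "\<dots> = coef u m ^ q * l"
    using q_pos by (simp add: coef_frobenius)
  finally show ?thesis
    using True by simp
next
  case False
  have "?lhs = 0"
  proof (rule coef_mult_term_eq_0[OF is_term_monomial])
    fix d
    assume "exponent (\<lambda>i. q * Poly_Mapping.lookup m i + a i) = d + exponent b"
    then have eq: "q * Poly_Mapping.lookup m i + a i = Poly_Mapping.lookup d i + b i" for i
      by (metis lookup_add lookup_exponent)
    have "\<not> (\<forall>i. q dvd Poly_Mapping.lookup d i)"
    proof
      assume dvd: "\<forall>i. q dvd Poly_Mapping.lookup d i"
      have "a i = b i" for i
      proof -
        have "a i = (q * Poly_Mapping.lookup m i + a i) mod q"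
          using less_q[OF a] by simp
        also have "\<dots> = b i"
          unfolding eq using dvd less_q[OF b] by (metis add_0 dvd_imp_mod_0 mod_add_left_eq mod_less)
        finally show ?thesis .
      qed
      with False show False by auto
    qed
    then show "coef (u ^ q) d = 0"
      by (simp only: coef_frobenius if_False)
  qed
  with False show ?thesis by simp
qed

lemma coef_frobenius_combination:
  assumes "finite \<Lambda>" and a: "a \<in> box q"
  shows "coef (\<Sum>(l, b)\<in>\<Lambda> \<times> box q. u l b ^ q * monomial l b)
        (exponent (\<lambda>i. q * Poly_Mapping.lookup m i + a i)) =
      (\<Sum>l\<in>\<Lambda>. coef (u l a) m ^ q * l)"
proof -
  have "coef (\<Sum>(l, b)\<in>\<Lambda> \<times> box q. u l b ^ q * monomial l b)
        (exponent (\<lambda>i. q * Poly_Mapping.lookup m i + a i)) =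
      (\<Sum>l\<in>\<Lambda>. \<Sum>b\<in>box q. coef (u l b ^ q * monomial l b)
        (exponent (\<lambda>i. q * Poly_Mapping.lookup m i + a i)))"
    by (simp add: coef_sum sum.cartesian_product case_prod_unfold)
  also have "\<dots> = (\<Sum>l\<in>\<Lambda>. \<Sum>b\<in>box q. if a = b then coef (u l b) m ^ q * l else 0)"
    by (intro sum.cong refl coef_frobenius_mult_monomial a)
  also have "\<dots> = (\<Sum>l\<in>\<Lambda>. coef (u l a) m ^ q * l)"
    using a finite_box[of q, where 'n = 'n] by simp
  finally show ?thesis .
qed

context
  fixes \<Lambda> :: "'k set"
  assumes fin: "finite \<Lambda>"
    and indep: "\<not> module.dependent (frob_scale p e (*)) \<Lambda>"
    and span: "module.span (frob_scale p e (*)) \<Lambda> = UNIV"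
begin

interpretation FK: module "frob_scale p e ((*) :: 'k \<Rightarrow> 'k \<Rightarrow> 'k)"
  by (rule module_frob_scale[OF p])

interpretation FS: module "frob_scale p e ((*) :: 's \<Rightarrow> 's \<Rightarrow> 's)"
  by (rule module_frob_scale[OF p(1) CHAR_S])

lemma finite_Delta: "finite (Delta C X \<Lambda> q)"
  unfolding Delta_eq using fin finite_box by blast

text \<open>
  \<open>Delta\<close> is a set of ring elements, so a sum over it is a sum over pairs only because distinct
  pairs give distinct monomials. This needs that 0 is not in \<open>\<Lambda>\<close>.
\<close>

lemma sum_Delta:
  "(\<Sum>v\<in>Delta C X \<Lambda> q. frob_scale p e (*) (u v) v) =
    (\<Sum>(l, b)\<in>\<Lambda> \<times> box q. u (monomial l b) ^ q * monomial l b)"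
proof -
  have "0 \<notin> \<Lambda>"
    using FK.dependent_zero indep by blast
  then show ?thesis
    unfolding Delta_eq
    by (subst sum.reindex[OF inj_on_monomial])
       (auto simp: frob_scale_def q case_prod_unfold intro!: sum.cong)
qed

lemma independent_Delta: "\<not> module.dependent (frob_scale p e (*)) (Delta C X \<Lambda> q)"
proof
  assume "FS.dependent (Delta C X \<Lambda> q)"
  then obtain u v where v: "v \<in> Delta C X \<Lambda> q" "u v \<noteq> 0"
    and 0: "(\<Sum>v\<in>Delta C X \<Lambda> q. frob_scale p e (*) (u v) v) = 0"
    by (auto simp: FS.dependent_finite[OF finite_Delta])
  obtain l a where l: "l \<in> \<Lambda>" and a: "a \<in> box q" and v_eq: "v = monomial l a"
    using v(1) by (auto simp: Delta_eq)
  have "coef (u v) m = 0" for m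
  proof -
    have "(\<Sum>l\<in>\<Lambda>. frob_scale p e (*) (coef (u (monomial l a)) m) l) = 0"
      using coef_frobenius_combination[OF fin a, of "\<lambda>l b. u (monomial l b)" m]
      unfolding sum_Delta[symmetric] 0 by (simp add: frob_scale_def q)
    then show ?thesis
      using FK.independentD[OF indep fin subset_refl _ l, of "\<lambda>l. coef (u (monomial l a)) m"]
      by (simp add: v_eq)
  qed
  then have "u v = 0"
    by (intro coef_ext) simp
  with v show False by simp
qed

lemma span_Delta: "module.span (frob_scale p e (*)) (Delta C X \<Lambda> q) = UNIV"
proof -
  have "s \<in> FS.span (Delta C X \<Lambda> q)" for s
  proof -
    let ?rep = "FK.representation \<Lambda>"
    \<comment> \<open>The coefficient of \<open>s\<close> in front of \<open>monomial l a\<close>: collect the \<open>l\<close>-coordinates of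
      the coefficients of \<open>s\<close> at the exponents congruent to \<open>a\<close>.\<close>
    have "\<forall>l a. \<exists>w. \<forall>m. coef w m =
        ?rep (coef s (exponent (\<lambda>i. q * Poly_Mapping.lookup m i + a i))) l"
    proof (intro allI coef_closed)
      fix l and a :: "'n \<Rightarrow> nat"
      show "?rep 0 l = 0"
        by (simp add: FK.representation_zero)
      show "inj (\<lambda>m. exponent (\<lambda>i. q * Poly_Mapping.lookup m i + a i))"
        using q_pos by (auto intro!: injI poly_mapping_eqI simp: fun_eq_iff)
    qed
    then obtain w where w: "\<And>l a m. coef (w l a) m =
        ?rep (coef s (exponent (\<lambda>i. q * Poly_Mapping.lookup m i + a i))) l"
      unfolding choice_iff by blast
    have "s = (\<Sum>(l, b)\<in>\<Lambda> \<times> box q. w l b ^ q * monomial l b)"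
    proof (rule coef_ext)
      fix m :: "'n \<Rightarrow>\<^sub>0 nat"
      let ?m = "exponent (\<lambda>i. Poly_Mapping.lookup m i div q)"
      let ?a = "\<lambda>i. Poly_Mapping.lookup m i mod q"
      have a: "?a \<in> box q"
        using q_pos by (auto simp: box_def less_Suc_eq_le[symmetric])
      have m: "exponent (\<lambda>i. q * Poly_Mapping.lookup ?m i + ?a i) = m"
        by simp
      have "coef s m = (\<Sum>l\<in>\<Lambda>. frob_scale p e (*) (?rep (coef s m) l) l)"
        using indep fin span by (simp add: FK.sum_representation_eq)
      also have "\<dots> = (\<Sum>l\<in>\<Lambda>. coef (w l ?a) ?m ^ q * l)"
        unfolding w m by (simp add: frob_scale_def q)
      also have "\<dots> = coef (\<Sum>(l, b)\<in>\<Lambda> \<times> box q. w l b ^ q * monomial l b) m"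
        using coef_frobenius_combination[OF fin a, of w ?m] unfolding m by simp
      finally show "coef s m = coef (\<Sum>(l, b)\<in>\<Lambda> \<times> box q. w l b ^ q * monomial l b) m" .
    qed
    also have "\<dots> = (\<Sum>(l, b)\<in>\<Lambda> \<times> box q. frob_scale p e (*) (w l b) (monomial l b))"
      by (simp add: frob_scale_def q)
    also have "\<dots> \<in> FS.span (Delta C X \<Lambda> q)"
      unfolding case_prod_unfold
      by (intro FS.span_sum FS.span_scale FS.span_base) (auto simp: Delta_eq)
    finally show ?thesis .
  qed
  then show ?thesis by auto
qed

lemma matrix_factorization_M_matrix:
  assumes "k \<le> q" "f \<noteq> 0"
  shows "matrix_factorization (Delta C X \<Lambda> q) f
           (M_matrix p C X \<Lambda> (f ^ k) e) (M_matrix p C X \<Lambda> (f ^ (q - k)) e)"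
  using frobenius_matrix_factorization[OF p(1) CHAR_S finite_Delta[unfolded q]
      independent_Delta[unfolded q] span_Delta[unfolded q]] assms
  by (simp add: q)

end

end

section \<open>Polynomials and power series\<close>

lemma lookup_mult_decomp:
  fixes f g :: "('n, 'k::comm_ring_1) mpoly"
  shows "Poly_Mapping.lookup (f * g) m =
    (\<Sum>(a, b) | a + b = m. Poly_Mapping.lookup f a * Poly_Mapping.lookup g b)"
proof -
  let ?A = "fst ` {(a, b). a + b = m}"
  have inner: "(\<Sum>b. Poly_Mapping.lookup g b when m = a + b) =
      (if a \<in> ?A then Poly_Mapping.lookup g (m - a) else 0)" for a
  proof (cases "a \<in> ?A")
    case True
    then obtain c where "m = a + c" by auto
    then show ?thesis
      using True by (simp add: eq_commute[of c])
  next
    case False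
    then have "m \<noteq> a + b" for b by force
    with False show ?thesis by simp
  qed
  have "Poly_Mapping.lookup (f * g) m = (\<Sum>a. Poly_Mapping.lookup f a *
      (if a \<in> ?A then Poly_Mapping.lookup g (m - a) else 0))"
    by (simp only: lookup_mult inner)
  also have "\<dots> = (\<Sum>a\<in>?A. Poly_Mapping.lookup f a *
      (if a \<in> ?A then Poly_Mapping.lookup g (m - a) else 0))"
    by (rule Sum_any.expand_superset) (use finite_exponent_decomp[of m] in \<open>auto split: if_splits\<close>)
  also have "\<dots> = (\<Sum>a\<in>?A. Poly_Mapping.lookup f a * Poly_Mapping.lookup g (m - a))"
    by (rule sum.cong) auto
  also have "\<dots> = (\<Sum>(a, b) | a + b = m. Poly_Mapping.lookup f a * Poly_Mapping.lookup g b)"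
    by (subst sum.reindex) (auto simp: inj_on_def case_prod_unfold intro!: sum.cong)
  finally show ?thesis .
qed

lemma coefficient_ring_mpoly:
  "coefficient_ring mpoly_const (mpoly_var :: 'n::finite \<Rightarrow> ('n, 'k::field) mpoly) Poly_Mapping.lookup"
proof
  fix g :: "'k \<Rightarrow> 'k" and h :: "('n \<Rightarrow>\<^sub>0 nat) \<Rightarrow> 'n \<Rightarrow>\<^sub>0 nat" and f :: "('n, 'k) mpoly"
  assume g: "g 0 = 0" and h: "inj h"
  have "{m. g (Poly_Mapping.lookup f (h m)) \<noteq> 0} \<subseteq> h -` Poly_Mapping.keys f"
    using g by (auto simp: in_keys_iff)
  then have "finite {m. g (Poly_Mapping.lookup f (h m)) \<noteq> 0}"
    using h by (meson finite_keys finite_subset finite_vimageI)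
  then show "\<exists>u. \<forall>m. Poly_Mapping.lookup u m = g (Poly_Mapping.lookup f (h m))"
    by (metis lookup_Abs_poly_mapping)
qed (auto simp: lookup_add lookup_mult_decomp mpoly_const_def mpoly_var_def lookup_single when_def
    intro: poly_mapping_eqI)

lemma coefficient_ring_mfps:
  "coefficient_ring mfps_const (mfps_var :: 'n::finite \<Rightarrow> ('n, 'k::field) mfps) mfps_nth"
proof
  fix g :: "'k \<Rightarrow> 'k" and h :: "('n \<Rightarrow>\<^sub>0 nat) \<Rightarrow> 'n \<Rightarrow>\<^sub>0 nat" and f :: "('n, 'k) mfps"
  show "\<exists>u :: ('n, 'k) mfps. \<forall>m. mfps_nth u m = g (mfps_nth f (h m))"
    by (rule exI[of _ "Abs_mfps (\<lambda>m. g (mfps_nth f (h m)))"]) simp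
qed (auto simp: plus_mfps_def times_mfps_def mfps_const_def mfps_var_def intro: mfps_ext)

theorem proposition5p6:
  fixes p e q k :: nat
    and \<Lambda> :: "'k::field set"
  assumes "prime p" and "CHAR('k) = p"
    and "finite_degree_over (powers_subfield p :: 'k set)"
    and "e \<ge> 1" and "q = p ^ e"
    and "basis_over (powers_subfield (p ^ e)) \<Lambda>"
    and "k \<le> q - 1"
  shows "(\<forall>f :: ('n::finite, 'k) mpoly. f \<noteq> 0 \<longrightarrow>
            matrix_factorization (Delta mpoly_const (mpoly_var :: 'n \<Rightarrow> ('n, 'k) mpoly) \<Lambda> q) f
              (M_matrix p mpoly_const (mpoly_var :: 'n \<Rightarrow> ('n, 'k) mpoly) \<Lambda> (f ^ k) e)
              (M_matrix p mpoly_const (mpoly_var :: 'n \<Rightarrow> ('n, 'k) mpoly) \<Lambda> (f ^ (q - k)) e)) \<and>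
         (\<forall>f :: ('n, 'k) mfps. f \<noteq> 0 \<longrightarrow>
            matrix_factorization (Delta mfps_const (mfps_var :: 'n \<Rightarrow> ('n, 'k) mfps) \<Lambda> q) f
              (M_matrix p mfps_const (mfps_var :: 'n \<Rightarrow> ('n, 'k) mfps) \<Lambda> (f ^ k) e)
              (M_matrix p mfps_const (mfps_var :: 'n \<Rightarrow> ('n, 'k) mfps) \<Lambda> (f ^ (q - k)) e))"
proof -
  have \<Lambda>: "finite \<Lambda>" "\<not> module.dependent (frob_scale p e (*)) \<Lambda>"
    "module.span (frob_scale p e (*)) \<Lambda> = UNIV"
    using finite_basis_of_frobenius_field independent_of_basis_over span_of_basis_over assms
    by blast+
  have k: "k \<le> q"
    using assms by simp
  have "frobenius_coefficient_ring mpoly_const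
      (mpoly_var :: 'n \<Rightarrow> ('n, 'k) mpoly) Poly_Mapping.lookup p e q"
    and "frobenius_coefficient_ring mfps_const (mfps_var :: 'n \<Rightarrow> ('n, 'k) mfps) mfps_nth p e q"
    using coefficient_ring_mpoly coefficient_ring_mfps assms
    by (auto simp: frobenius_coefficient_ring_def frobenius_coefficient_ring_axioms_def)
  from this[THEN frobenius_coefficient_ring.matrix_factorization_M_matrix[OF _ \<Lambda> k]]
  show ?thesis by simp
qed

end
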